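(* Let $n \ge 1$ and let $\boldsymbol{p} > \boldsymbol{0}$ and $\boldsymbol{q} > \boldsymbol{0}$ be $n$-dimensional stochastic vectors. Then the matrix $\overline{U}$ corresponding to $(\boldsymbol{p},\boldsymbol{q})$ is an optimal solution of the linear program $$\text{(P)}\qquad \max\{\operatorname{tr}(U) : U \in \mathcal{U}\},$$ and the triple $(\overline{\boldsymbol{\alpha}}, \overline{\boldsymbol{\beta}}, \overline{\Gamma})$ corresponding to $(\boldsymbol{p},\boldsymbol{q})$ is an optimal solution of the linear program $$\text{(D)}\qquad \min_{\boldsymbol{\alpha},\boldsymbol{\beta}\in\mathbb{R}^n,\ \Gamma\in\mathbb{R}^{n\times n}}\ \{\boldsymbol{\alpha}^\top \boldsymbol{p} + \boldsymbol{\beta}^\top \boldsymbol{1} : \boldsymbol{q}\boldsymbol{\alpha}^\top + \boldsymbol{\beta}\boldsymbol{1}^\top - \Gamma = I,\ \Gamma \ge 0\}.$$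
   Context: Vectors are column vectors; inequalities between vectors or matrices are entrywise; $\boldsymbol{1}$ is the all-ones vector, $\boldsymbol{0}$ the zero vector, $I$ the identity matrix. A vector $\boldsymbol{a}\in\mathbb{R}^n$ is stochastic if $\boldsymbol{a}^\top\boldsymbol{1}=1$ and $\boldsymbol{a}\ge\boldsymbol{0}$. Write $[c]^+=\max\{c,0\}$, and let $\mathbb{I}_{[\,\cdot\,]}$ be $1$ if the subscripted condition holds and $0$ otherwise. For $\boldsymbol{p},\boldsymbol{q}$ define $$\mathcal{U}=\{U\in\mathbb{R}^{n\times n}: U^\top\boldsymbol{q}=\boldsymbol{p},\ U\boldsymbol{1}=\boldsymbol{1},\ U\ge 0\}.$$ The matrix $\overline{U}\in\mathbb{R}^{n\times n}$ corresponding to $(\boldsymbol{p},\boldsymbol{q})$ has entries $$\overline{u}_{ij}=\begin{cases}1-[1-p_i/q_i]^+, & i=j,\\ 0, & i\ne j \text{ and } \boldsymbol{p}=\boldsymbol{q},\\ \dfrac{[1-p_i/q_i]^+\,[p_j-q_j]^+}{\sum_{k=1}^n[p_k-q_k]^+}, & i\neq j\text{ and }\boldsymbol{p}\ne\boldsymbol{q}.\end{cases}$$ The vectors $\overline{\boldsymbol{\alpha}},\overline{\boldsymbol{\beta}}\in\mathbb{R}^n$ and matrix $\overline{\Gamma}\in\mathbb{R}^{n\times n}$ corresponding to $(\boldsymbol{p},\boldsymbol{q})$ have entries $$\overline{\alpha}_j=\mathbb{I}_{[p_j<q_j]}/q_j,\qquad \overline{\beta}_i=\mathbb{I}_{[p_i\ge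 q_i]},\qquad \overline{\gamma}_{ij}=\mathbb{I}_{[p_i\ge q_i]}+\mathbb{I}_{[p_j<q_j]}\cdot q_i/q_j-\mathbb{I}_{[i=j]}.$$ *)

theory Defs
  imports "HOL-Analysis.Analysis"
begin

text \<open>
  The dimension \<open>n \<ge> 1\<close> is \<open>CARD('n)\<close> for a finite index type \<open>'n\<close>. On \<open>real^'n\<close> and on
  \<open>real^'n^'n\<close> the library order \<open>\<le>\<close> is entrywise, and \<open>1 :: real^'n\<close> is the all-ones vector.
  The identity matrix is \<open>mat 1\<close> (the constant \<open>1\<close> of type \<open>real^'n^'n\<close> is the all-ones matrix).
\<close>

definition stochastic :: "real^'n \<Rightarrow> bool" where
  "stochastic a \<longleftrightarrow> a \<bullet> 1 = 1 \<and> 0 \<le> a"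

text \<open>
  The library relation \<open>0 < a\<close> on vectors only means \<open>0 \<le> a\<close> and \<open>a \<noteq> 0\<close>, so entrywise
  strict positivity needs its own predicate.
\<close>

definition positive_vec :: "real^'n \<Rightarrow> bool" where
  "positive_vec a \<longleftrightarrow> (\<forall>i. 0 < a $ i)"

definition pos_part :: "real \<Rightarrow> real" where
  "pos_part c = max c 0"

definition outer_prod :: "real^'n \<Rightarrow> real^'n \<Rightarrow> real^'n^'n" where
  "outer_prod x y = (\<chi> i j. x $ i * y $ j)"

definition primal_feasible :: "real^'n \<Rightarrow> real^'n \<Rightarrow> (real^'n^'n) set" where
  "primal_feasible p q = {U. transpose U *v q = p \<and> U *v 1 = 1 \<and> 0 \<le> U}"

definition dual_feasible :: "real^'n \<Rightarrow> ((real^'n) \<times> (real^'n) \<times> (real^'n^'n)) set" where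
  "dual_feasible q =
     {(\<alpha>, \<beta>, \<Gamma>). outer_prod q \<alpha> + outer_prod \<beta> 1 - \<Gamma> = mat 1 \<and> 0 \<le> \<Gamma>}"

definition dual_objective :: "real^'n \<Rightarrow> (real^'n) \<times> (real^'n) \<times> (real^'n^'n) \<Rightarrow> real" where
  "dual_objective p = (\<lambda>(\<alpha>, \<beta>, \<Gamma>). \<alpha> \<bullet> p + \<beta> \<bullet> 1)"

definition U_bar :: "real^'n \<Rightarrow> real^'n \<Rightarrow> real^'n^'n" where
  "U_bar p q = (\<chi> i j.
     if i = j then 1 - pos_part (1 - p $ i / q $ i)
     else if p = q then 0
     else pos_part (1 - p $ i / q $ i) * pos_part (p $ j - q $ j) /
            (\<Sum>k\<in>UNIV. pos_part (p $ k - q $ k)))"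

definition alpha_bar :: "real^'n \<Rightarrow> real^'n \<Rightarrow> real^'n" where
  "alpha_bar p q = (\<chi> j. of_bool (p $ j < q $ j) / q $ j)"

definition beta_bar :: "real^'n \<Rightarrow> real^'n \<Rightarrow> real^'n" where
  "beta_bar p q = (\<chi> i. of_bool (p $ i \<ge> q $ i))"

definition Gamma_bar :: "real^'n \<Rightarrow> real^'n \<Rightarrow> real^'n^'n" where
  "Gamma_bar p q = (\<chi> i j.
     of_bool (p $ i \<ge> q $ i) + of_bool (p $ j < q $ j) * (q $ i / q $ j) - of_bool (i = j))"

end

theory Submission
  imports Defs
begin

text \<open>
  Think of \<open>U\<close> as transporting the mass distribution \<open>q\<close> to \<open>p\<close>; its trace adds
  up, over the coordinates, the fraction of mass that stays in place. A coordinate with \<open>p\<^sub>i <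
  q\<^sub>i\<close> can keep at most the fraction \<open>p\<^sub>i / q\<^sub>i\<close>, the others can keep
  everything, so no trace exceeds \<open>\<Sum>\<^sub>i min 1 (p\<^sub>i / q\<^sub>i)\<close>. The matrix \<open>U_bar
  p q\<close> attains this bound: each coordinate with \<open>p\<^sub>i < q\<^sub>i\<close> sends away precisely its
  excess \<open>q\<^sub>i - p\<^sub>i\<close> and distributes it over the coordinates in need, in proportion to their
  need. It is feasible because, \<open>p\<close> and \<open>q\<close> having equal total mass, total excess equals
  total need (\<open>sum_excess_eq_sum_need\<close>).

  Optimality of both solutions then follows from linear programming duality: by
  \<open>dual_objective_eq_trace_plus_slack\<close>, a dual objective value exceeds a primal one by the
  nonnegative number \<open>\<Sum>\<^sub>i\<^sub>j u\<^sub>i\<^sub>j \<gamma>\<^sub>i\<^sub>j\<close>, and the two given feasible points have the same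
  objective value, namely the bound above.
\<close>

lemma sum_pos_part_diff_commute:
  fixes f g :: "'a \<Rightarrow> real"
  assumes "sum f A = sum g A"
  shows "(\<Sum>i\<in>A. pos_part (f i - g i)) = (\<Sum>i\<in>A. pos_part (g i - f i))"
proof -
  have "(\<Sum>i\<in>A. pos_part (f i - g i)) - (\<Sum>i\<in>A. pos_part (g i - f i)) = (\<Sum>i\<in>A. f i - g i)"
    unfolding sum_subtractf [symmetric] by (rule sum.cong) (auto simp: pos_part_def)
  with assms show ?thesis
    by (simp add: sum_subtractf)
qed

lemma mult_pos_part_one_minus_divide:
  assumes "0 < b"
  shows "b * pos_part (1 - a / b) = pos_part (b - a)"
  using assms by (auto simp: pos_part_def max_def field_simps)

lemma sum_excess_eq_sum_need:
  fixes p q :: "real^'n"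
  assumes "stochastic p" "stochastic q" "positive_vec q"
  shows "(\<Sum>i\<in>UNIV. q $ i * pos_part (1 - p $ i / q $ i)) = (\<Sum>k\<in>UNIV. pos_part (p $ k - q $ k))"
proof -
  have "(\<Sum>i\<in>UNIV. p $ i) = (\<Sum>i\<in>UNIV. q $ i)"
    using assms by (simp add: stochastic_def inner_vec_def)
  then have "(\<Sum>i\<in>UNIV. pos_part (p $ i - q $ i)) = (\<Sum>i\<in>UNIV. pos_part (q $ i - p $ i))"
    by (rule sum_pos_part_diff_commute)
  then show ?thesis
    using assms by (simp add: positive_vec_def mult_pos_part_one_minus_divide)
qed

text \<open>
  The case distinction in the definition of \<open>U_bar\<close> is only apparent: no coordinate has both excess
  and need, so the rank-one term vanishes on the diagonal, and for \<open>p = q\<close> there is no excess at all.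
\<close>
lemma U_bar_eq_diagonal_plus_rank_one:
  fixes p q :: "real^'n"
  assumes "positive_vec q"
  shows "U_bar p q $ i $ j =
    of_bool (i = j) * (1 - pos_part (1 - p $ i / q $ i)) +
    pos_part (1 - p $ i / q $ i) * pos_part (p $ j - q $ j) / (\<Sum>k\<in>UNIV. pos_part (p $ k - q $ k))"
proof -
  have "0 < q $ i"
    using assms by (simp add: positive_vec_def)
  then have "pos_part (1 - p $ i / q $ i) * pos_part (p $ i - q $ i) = 0"
    and "p = q \<Longrightarrow> pos_part (1 - p $ i / q $ i) = 0"
    by (auto simp: pos_part_def max_def field_simps)
  then show ?thesis
    by (auto simp: U_bar_def)
qed

lemma U_bar_feasible:
  fixes p q :: "real^'n"
  assumes "stochastic p" "positive_vec p" "stochastic q" "positive_vec q"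
  shows "U_bar p q \<in> primal_feasible p q"
proof -
  define d where "d i = pos_part (1 - p $ i / q $ i)" for i
  define e where "e j = pos_part (p $ j - q $ j)" for j
  define S where "S = (\<Sum>k\<in>UNIV. e k)"
  have U: "U_bar p q $ i $ j = of_bool (i = j) * (1 - d i) + d i * e j / S" for i j
    using assms by (simp add: U_bar_eq_diagonal_plus_rank_one d_def e_def S_def)
  have pos: "0 < p $ i" "0 < q $ i" for i
    using assms by (simp_all add: positive_vec_def)
  have d: "0 \<le> d i" "d i \<le> 1" and e: "0 \<le> e i" for i
    using pos[of i] by (auto simp: d_def e_def pos_part_def)
  have S: "0 \<le> S"
    unfolding S_def by (intro sum_nonneg e)
  have excess: "(\<Sum>i\<in>UNIV. q $ i * d i) = S"
    using assms sum_excess_eq_sum_need[of p q] by (simp add: d_def e_def S_def)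
  (* If S = 0, the division by S yields 0, which is the right value since no mass has to move. *)
  have dS: "d i * S / S = d i" for i
  proof (cases "S = 0")
    case True
    then have "q $ i * d i = 0"
      using excess d pos sum_nonneg_eq_0_iff[of UNIV "\<lambda>i. q $ i * d i"]
      by (simp add: less_imp_le)
    with True pos[of i] show ?thesis by simp
  qed simp
  have eS: "S * e j / S = e j" for j
  proof (cases "S = 0")
    case True
    then have "e j = 0"
      using e sum_nonneg_eq_0_iff[of UNIV e] by (simp add: S_def)
    with True show ?thesis by simp
  qed simp
  have rows: "(\<Sum>j\<in>UNIV. U_bar p q $ i $ j) = 1" for i
  proof -
    have "(\<Sum>j\<in>UNIV. U_bar p q $ i $ j) = (1 - d i) + d i * S / S"
      by (simp add: U sum.distrib S_def sum_distrib_left sum_divide_distrib of_bool_def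
          if_distrib[of "\<lambda>x. x * _"] cong: if_cong)
    then show ?thesis
      by (simp only: dS diff_add_cancel)
  qed
  have columns: "(\<Sum>i\<in>UNIV. U_bar p q $ i $ j * q $ i) = p $ j" for j
  proof -
    have "(\<Sum>i\<in>UNIV. U_bar p q $ i $ j * q $ i) =
          (\<Sum>i\<in>UNIV. (if i = j then q $ i * (1 - d i) else 0) + q $ i * d i * e j / S)"
      by (rule sum.cong) (auto simp: U algebra_simps)
    also have "\<dots> = q $ j * (1 - d j) + (\<Sum>i\<in>UNIV. q $ i * d i) * e j / S"
      by (simp add: sum.distrib sum_distrib_right sum_divide_distrib)
    also have "\<dots> = q $ j - q $ j * d j + e j"
      by (simp only: excess eS right_diff_distrib mult_1_right)
    also have "\<dots> = p $ j"
      using mult_pos_part_one_minus_divide[OF pos(2), of j "p $ j"]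
      by (simp add: d_def e_def pos_part_def max_def)
    finally show ?thesis .
  qed
  have "0 \<le> U_bar p q $ i $ j" for i j
    using d[of i] e[of j] S by (simp add: U)
  with rows columns show ?thesis
    by (simp add: primal_feasible_def vec_eq_iff less_eq_vec_def matrix_vector_mult_def
        transpose_def)
qed

lemma bar_triple_feasible:
  fixes p q :: "real^'n"
  assumes "positive_vec q"
  shows "(alpha_bar p q, beta_bar p q, Gamma_bar p q) \<in> dual_feasible q"
proof -
  have pos: "0 < q $ i" for i
    using assms by (simp add: positive_vec_def)
  have "0 \<le> Gamma_bar p q $ i $ j" for i j
    using pos[of i] pos[of j] by (cases "i = j") (auto simp: Gamma_bar_def)
  then show ?thesis
    by (simp add: dual_feasible_def vec_eq_iff less_eq_vec_def outer_prod_def alpha_bar_def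
        beta_bar_def Gamma_bar_def mat_def)
qed

text \<open>
  Both sides arise from \<open>\<Sum>\<^sub>i\<^sub>j u\<^sub>i\<^sub>j (q\<^sub>i \<alpha>\<^sub>j + \<beta>\<^sub>i)\<close>: the primal constraints evaluate it to the
  dual objective, and the dual constraint turns the bracket into \<open>\<delta>\<^sub>i\<^sub>j + \<gamma>\<^sub>i\<^sub>j\<close>.
\<close>
lemma dual_objective_eq_trace_plus_slack:
  fixes p q :: "real^'n"
  assumes U: "U \<in> primal_feasible p q" and dual: "(\<alpha>, \<beta>, \<Gamma>) \<in> dual_feasible q"
  shows "dual_objective p (\<alpha>, \<beta>, \<Gamma>) = trace U + (\<Sum>i\<in>UNIV. \<Sum>j\<in>UNIV. U $ i $ j * \<Gamma> $ i $ j)"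
proof -
  have columns: "p $ j = (\<Sum>i\<in>UNIV. U $ i $ j * q $ i)"
    and rows: "(\<Sum>j\<in>UNIV. U $ i $ j) = 1" for i j
    using U by (auto simp: primal_feasible_def vec_eq_iff matrix_vector_mult_def transpose_def)
  have eq: "q $ i * \<alpha> $ j + \<beta> $ i = of_bool (i = j) + \<Gamma> $ i $ j" for i j
    using dual by (auto simp: dual_feasible_def vec_eq_iff outer_prod_def mat_def
        algebra_simps of_bool_def)
  have "dual_objective p (\<alpha>, \<beta>, \<Gamma>) =
        (\<Sum>j\<in>UNIV. \<alpha> $ j * (\<Sum>i\<in>UNIV. U $ i $ j * q $ i)) +
        (\<Sum>i\<in>UNIV. \<beta> $ i * (\<Sum>j\<in>UNIV. U $ i $ j))"
    by (simp add: dual_objective_def inner_vec_def rows columns)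
  also have "(\<Sum>j\<in>UNIV. \<alpha> $ j * (\<Sum>i\<in>UNIV. U $ i $ j * q $ i)) =
        (\<Sum>i\<in>UNIV. \<Sum>j\<in>UNIV. \<alpha> $ j * (U $ i $ j * q $ i))"
    unfolding sum_distrib_left by (rule sum.swap)
  also have "\<dots> + (\<Sum>i\<in>UNIV. \<beta> $ i * (\<Sum>j\<in>UNIV. U $ i $ j)) =
        (\<Sum>i\<in>UNIV. \<Sum>j\<in>UNIV. U $ i $ j * (q $ i * \<alpha> $ j + \<beta> $ i))"
    by (simp add: sum_distrib_left sum.distrib algebra_simps)
  also have "\<dots> = trace U + (\<Sum>i\<in>UNIV. \<Sum>j\<in>UNIV. U $ i $ j * \<Gamma> $ i $ j)"
    by (simp add: eq trace_def distrib_left sum.distrib of_bool_def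
        if_distrib[of "\<lambda>x. _ * x"] cong: if_cong)
  finally show ?thesis .
qed

lemma trace_le_dual_objective:
  fixes p q :: "real^'n"
  assumes "U \<in> primal_feasible p q" and "z \<in> dual_feasible q"
  shows "trace U \<le> dual_objective p z"
proof -
  obtain \<alpha> \<beta> \<Gamma> where z: "z = (\<alpha>, \<beta>, \<Gamma>)"
    by (rule prod_cases3)
  have "0 \<le> U" "0 \<le> \<Gamma>"
    using assms by (auto simp: z primal_feasible_def dual_feasible_def)
  then have "0 \<le> (\<Sum>i\<in>UNIV. \<Sum>j\<in>UNIV. U $ i $ j * \<Gamma> $ i $ j)"
    by (auto simp: less_eq_vec_def intro!: sum_nonneg mult_nonneg_nonneg)
  with dual_objective_eq_trace_plus_slack assms show ?thesis
    by (fastforce simp: z)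
qed

lemma trace_U_bar_eq_dual_objective:
  fixes p q :: "real^'n"
  assumes "positive_vec q"
  shows "trace (U_bar p q) = dual_objective p (alpha_bar p q, beta_bar p q, Gamma_bar p q)"
proof -
  have "1 - pos_part (1 - p $ i / q $ i) =
        of_bool (p $ i < q $ i) / q $ i * p $ i + of_bool (p $ i \<ge> q $ i)" for i
  proof -
    have "0 < q $ i"
      using assms by (simp add: positive_vec_def)
    then show ?thesis
      by (auto simp: pos_part_def max_def field_simps)
  qed
  then show ?thesis
    by (simp add: trace_def U_bar_def dual_objective_def alpha_bar_def beta_bar_def
        inner_vec_def sum.distrib)
qed

theorem theorem4:
  fixes p q :: "real^'n"
  assumes "stochastic p" and "positive_vec p"
    and "stochastic q" and "positive_vec q"
  shows "is_arg_max trace (\<lambda>U. U \<in> primal_feasible p q) (U_bar p q) \<and>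
         is_arg_min (dual_objective p) (\<lambda>z. z \<in> dual_feasible q)
           (alpha_bar p q, beta_bar p q, Gamma_bar p q)"
proof -
  let ?z = "(alpha_bar p q, beta_bar p q, Gamma_bar p q)"
  have primal: "U_bar p q \<in> primal_feasible p q"
    using assms by (rule U_bar_feasible)
  have dual: "?z \<in> dual_feasible q"
    using assms(4) by (rule bar_triple_feasible)
  have gap: "trace (U_bar p q) = dual_objective p ?z"
    using assms(4) by (rule trace_U_bar_eq_dual_objective)
  have "trace U \<le> trace (U_bar p q)" if "U \<in> primal_feasible p q" for U
    unfolding gap using that dual by (rule trace_le_dual_objective)
  moreover have "dual_objective p ?z \<le> dual_objective p z" if "z \<in> dual_feasible q" for z
    unfolding gap[symmetric] using primal that by (rule trace_le_dual_objective)
  ultimately show ?thesis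
    using primal dual by (simp add: is_arg_max_linorder is_arg_min_linorder)
qed

end
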